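(* Let $P$ be a dcpo satisfying the following two conditions: (1) $P$ with its Scott topology is bounded-sober; (2) every element of $P$ is the supremum of a directed set of quasicontinuous elements of $P$. Then $P$ is $C_{\sigma}$-unique.
   Context: A dcpo (directed complete poset) is a poset in which every directed (in particular nonempty) subset has a supremum. For a poset $P$ and $A\subseteq P$, $\downarrow A=\{x\in P: x\le y\text{ for some }y\in A\}$, $\uparrow A=\{x\in P: y\le x\text{ for some }y\in A\}$, and $\downarrow a=\downarrow\{a\}$. A subset $A$ of a dcpo $P$ is Scott closed if $A=\downarrow A$ and $\bigvee D\in A$ for every directed $D\subseteq A$; these are the closed sets of the Scott topology. $C_{\sigma}(P)$ is the lattice of all Scott closed subsets of $P$ (including $\emptyset$), ordered by inclusion. A dcpo $P$ is $C_{\sigma}$-unique if for every dcpo $Q$, whenever the lattices $C_{\sigma}(P)$ and $C_{\sigma}(Q)$ are isomorphic, $P$ and $Q$ are order-isomorphic. A subset $A$ of a topological space is irreducible if whenever $A\subseteq F_1\cup F_2$ with $F_1,F_2$ closed, then $A\subseteq F_1$ or $A\subseteq F_2$. A $T_0$ space is bounded-sober if every nonempty closed irreducible subset that has an upper bound with respect to the specialization order ($x\le y$ iff $x\in cl(\{y\})$) is the closure of a point. For the Scott topology of a dcpo the specialization order is the original order. For a finite subset $F$ of a dcpo $P$ and $a\in P$, write $F\ll a$ if for every directed $D\subseteq P$, $a\le\bigvee D$ implies $D\cap\uparrow F\ne\emptyset$. A dcpo $P$ is quasicontinuous if for every $x\in P$ the family $\mathit{fin}(x)=\{F: F\text{ is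 finite and }F\ll x\}$ is directed (it is nonempty and for any $F_1,F_2\in \mathit{fin}(x)$ there is $F\in \mathit{fin}(x)$ with $F\subseteq\uparrow F_1\cap\uparrow F_2$), and for every $y\in P$ with $x\not\le y$ there is $F\in \mathit{fin}(x)$ with $y\notin\uparrow F$. An element $x$ of a dcpo $P$ is quasicontinuous if the dcpo $\downarrow x$ (with the induced order) is a quasicontinuous dcpo. *)

theory Defs
  imports "HOL-Analysis.Analysis" "HOL-Library.Lub_Glb"
begin

text \<open>
  A poset is a carrier set \<open>P\<close> of elements of a partially ordered type, with the induced order
  (the carrier may be empty).  All notions are relative to \<open>P\<close>: in particular suprema are
  taken in \<open>P\<close>, via \<^const>\<open>isLub\<close>\<open> P D s\<close>, and not in the ambient type.  Thus sub-posets such as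
  principal ideals, and families of sets ordered by inclusion, are posets in the same sense.
\<close>

definition directed_set :: "'a::order set \<Rightarrow> bool" where
  "directed_set D \<longleftrightarrow> D \<noteq> {} \<and> (\<forall>x\<in>D. \<forall>y\<in>D. \<exists>z\<in>D. x \<le> z \<and> y \<le> z)"

definition dcpo :: "'a::order set \<Rightarrow> bool" where
  "dcpo P \<longleftrightarrow> (\<forall>D. D \<subseteq> P \<and> directed_set D \<longrightarrow> (\<exists>s. isLub P D s))"

definition down :: "'a::order set \<Rightarrow> 'a set \<Rightarrow> 'a set" where
  "down P A = {x \<in> P. \<exists>y\<in>A. x \<le> y}"

definition up :: "'a::order set \<Rightarrow> 'a set \<Rightarrow> 'a set" where
  "up P A = {x \<in> P. \<exists>y\<in>A. y \<le> x}"

definition order_isomorphic :: "'a::order set \<Rightarrow> 'b::order set \<Rightarrow> bool" where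
  "order_isomorphic P Q \<longleftrightarrow>
     (\<exists>f. bij_betw f P Q \<and> (\<forall>x\<in>P. \<forall>y\<in>P. f x \<le> f y \<longleftrightarrow> x \<le> y))"

definition scott_closed :: "'a::order set \<Rightarrow> 'a set \<Rightarrow> bool" where
  "scott_closed P A \<longleftrightarrow> A \<subseteq> P \<and> A = down P A \<and>
     (\<forall>D s. D \<subseteq> A \<and> directed_set D \<and> isLub P D s \<longrightarrow> s \<in> A)"

definition C_sigma :: "'a::order set \<Rightarrow> 'a set set" where
  "C_sigma P = {A. scott_closed P A}"

definition scott_topology :: "'a::order set \<Rightarrow> 'a topology" where
  "scott_topology P = topology (\<lambda>U. U \<subseteq> P \<and> scott_closed P (P - U))"

text \<open>
  The lattice of Scott closed sets is ordered by inclusion, the order of the type \<^typ>\<open>'a set\<close>;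
  a lattice isomorphism is the same as an isomorphism of the underlying posets.

  HOL cannot quantify over types within a formula, so the type in which the dcpos \<open>Q\<close> live is
  a parameter.  A theorem with a free type variable in this place speaks about all dcpos.
\<close>

definition C_sigma_unique :: "'b::order itself \<Rightarrow> 'a::order set \<Rightarrow> bool" where
  "C_sigma_unique TYPE('b) P \<longleftrightarrow>
     (\<forall>Q :: 'b set. dcpo Q \<longrightarrow> order_isomorphic (C_sigma P) (C_sigma Q) \<longrightarrow> order_isomorphic P Q)"

definition irreducible_in :: "'a topology \<Rightarrow> 'a set \<Rightarrow> bool" where
  "irreducible_in X A \<longleftrightarrow>
     (\<forall>F1 F2. closedin X F1 \<and> closedin X F2 \<and> A \<subseteq> F1 \<union> F2 \<longrightarrow> A \<subseteq> F1 \<or> A \<subseteq> F2)"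

definition specialization_le :: "'a topology \<Rightarrow> 'a \<Rightarrow> 'a \<Rightarrow> bool" where
  "specialization_le X x y \<longleftrightarrow> x \<in> X closure_of {y}"

definition bounded_sober :: "'a topology \<Rightarrow> bool" where
  "bounded_sober X \<longleftrightarrow> t0_space X \<and>
     (\<forall>A. closedin X A \<and> A \<noteq> {} \<and> irreducible_in X A \<and>
        (\<exists>u\<in>topspace X. \<forall>a\<in>A. specialization_le X a u) \<longrightarrow>
        (\<exists>x\<in>topspace X. A = X closure_of {x}))"

definition way_below_set :: "'a::order set \<Rightarrow> 'a set \<Rightarrow> 'a \<Rightarrow> bool" where
  "way_below_set P F a \<longleftrightarrow>
     (\<forall>D s. D \<subseteq> P \<and> directed_set D \<and> isLub P D s \<and> a \<le> s \<longrightarrow> D \<inter> up P F \<noteq> {})"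

definition fin :: "'a::order set \<Rightarrow> 'a \<Rightarrow> 'a set set" where
  "fin P x = {F. F \<subseteq> P \<and> finite F \<and> way_below_set P F x}"

definition quasicontinuous :: "'a::order set \<Rightarrow> bool" where
  "quasicontinuous P \<longleftrightarrow> dcpo P \<and>
     (\<forall>x\<in>P.
        fin P x \<noteq> {} \<and>
        (\<forall>F1\<in>fin P x. \<forall>F2\<in>fin P x. \<exists>F\<in>fin P x. F \<subseteq> up P F1 \<inter> up P F2) \<and>
        (\<forall>y\<in>P. \<not> x \<le> y \<longrightarrow> (\<exists>F\<in>fin P x. y \<notin> up P F)))"

definition quasicontinuous_element :: "'a::order set \<Rightarrow> 'a \<Rightarrow> bool" where
  "quasicontinuous_element P x \<longleftrightarrow> x \<in> P \<and> quasicontinuous (down P {x})"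

text \<open>
  The Scott closed sets are indeed the closed sets of a topology on \<open>P\<close>, with specialization
  order the order of \<open>P\<close>.
\<close>

lemma scott_closed_Un:
  assumes A: "scott_closed P A" and B: "scott_closed P B"
  shows "scott_closed P (A \<union> B)"
  unfolding scott_closed_def
proof (intro conjI allI impI)
  show "A \<union> B \<subseteq> P" using A B by (auto simp: scott_closed_def)
  have "down P (A \<union> B) = down P A \<union> down P B" by (auto simp: down_def)
  then show "A \<union> B = down P (A \<union> B)"
    using A B by (simp add: scott_closed_def)
next
  fix D s assume D: "D \<subseteq> A \<union> B \<and> directed_set D \<and> isLub P D s"
  have lower: "x \<in> A" if "x \<le> y" "y \<in> A" "x \<in> P" for x y
  proof -
    have "x \<in> down P A" using that by (auto simp: down_def)
    then show ?thesis using A by (simp add: scott_closed_def)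
  qed
  have lower': "x \<in> B" if "x \<le> y" "y \<in> B" "x \<in> P" for x y
  proof -
    have "x \<in> down P B" using that by (auto simp: down_def)
    then show ?thesis using B by (simp add: scott_closed_def)
  qed
  have DP: "D \<subseteq> P" using D A B by (auto simp: scott_closed_def)
  have "D \<subseteq> A \<or> D \<subseteq> B"
  proof (rule ccontr)
    assume "\<not> (D \<subseteq> A \<or> D \<subseteq> B)"
    then obtain x y where "x \<in> D" "x \<notin> A" "y \<in> D" "y \<notin> B" by blast
    moreover then obtain z where "z \<in> D" "x \<le> z" "y \<le> z"
      using D unfolding directed_set_def by blast
    ultimately show False using lower lower' D DP by blast
  qed
  then show "s \<in> A \<union> B" using A B D unfolding scott_closed_def by blast
qed

lemma scott_closed_Inter:
  assumes "\<K> \<noteq> {}" and "\<And>A. A \<in> \<K> \<Longrightarrow> scott_closed P A"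
  shows "scott_closed P (\<Inter>\<K>)"
  unfolding scott_closed_def
proof (intro conjI allI impI)
  show "\<Inter>\<K> \<subseteq> P" using assms unfolding scott_closed_def by blast
  then have "\<Inter>\<K> \<subseteq> down P (\<Inter>\<K>)" by (auto simp: down_def)
  moreover have "down P (\<Inter>\<K>) \<subseteq> A" if "A \<in> \<K>" for A
  proof -
    have "down P (\<Inter>\<K>) \<subseteq> down P A" using that by (auto simp: down_def)
    also have "\<dots> = A" using assms(2)[OF that] by (simp add: scott_closed_def)
    finally show ?thesis .
  qed
  ultimately show "\<Inter>\<K> = down P (\<Inter>\<K>)" by blast
next
  fix D s assume "D \<subseteq> \<Inter>\<K> \<and> directed_set D \<and> isLub P D s"
  then show "s \<in> \<Inter>\<K>" using assms(2) unfolding scott_closed_def by blast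
qed

lemma scott_closed_empty: "scott_closed P {}"
  by (auto simp: scott_closed_def down_def directed_set_def)

lemma scott_closed_carrier: "scott_closed P P"
  by (auto simp: scott_closed_def down_def dest: isLubD1a)

lemma openin_scott_topology:
  "openin (scott_topology P) U \<longleftrightarrow> U \<subseteq> P \<and> scott_closed P (P - U)"
proof -
  have "istopology (\<lambda>U. U \<subseteq> P \<and> scott_closed P (P - U))"
    unfolding istopology_def
  proof (intro conjI allI impI)
    fix S T assume "S \<subseteq> P \<and> scott_closed P (P - S)" "T \<subseteq> P \<and> scott_closed P (P - T)"
    then show "S \<inter> T \<subseteq> P" "scott_closed P (P - S \<inter> T)"
      using scott_closed_Un[of P "P - S" "P - T"] by (auto simp: Diff_Int)
  next
    fix \<K> assume K: "\<forall>S\<in>\<K>. S \<subseteq> P \<and> scott_closed P (P - S)"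
    then show "\<Union>\<K> \<subseteq> P" by blast
    show "scott_closed P (P - \<Union>\<K>)"
    proof (cases "\<K> = {}")
      case True then show ?thesis by (simp add: scott_closed_carrier)
    next
      case False
      then have "P - \<Union>\<K> = \<Inter>((\<lambda>S. P - S) ` \<K>)" by blast
      with False K show ?thesis
        using scott_closed_Inter[of "(\<lambda>S. P - S) ` \<K>" P] by auto
    qed
  qed
  then show ?thesis unfolding scott_topology_def by (simp add: topology_inverse')
qed

lemma topspace_scott_topology [simp]: "topspace (scott_topology P) = P"
proof
  show "topspace (scott_topology P) \<subseteq> P"
    unfolding topspace_def by (auto simp: openin_scott_topology)
  have "openin (scott_topology P) P"
    by (simp add: openin_scott_topology scott_closed_empty)
  then show "P \<subseteq> topspace (scott_topology P)" by (rule openin_subset)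
qed

lemma closedin_scott_topology: "closedin (scott_topology P) A \<longleftrightarrow> scott_closed P A"
proof -
  have "scott_closed P A \<Longrightarrow> A \<subseteq> P" by (simp add: scott_closed_def)
  then show ?thesis by (auto simp: closedin_def openin_scott_topology double_diff)
qed

lemma scott_closed_down_singleton: "x \<in> P \<Longrightarrow> scott_closed P (down P {x})"
proof -
  assume x: "x \<in> P"
  have "s \<in> down P {x}" if "D \<subseteq> down P {x}" "isLub P D s" for D s
    using that x isLub_le_isUb[of P D s x] isLubD1a[of P D s]
    by (auto simp: down_def isUb_def setle_def)
  moreover have "down P {x} = down P (down P {x})"
    unfolding down_def using order_trans by fast
  moreover have "down P {x} \<subseteq> P" by (auto simp: down_def)
  ultimately show ?thesis unfolding scott_closed_def by blast
qed

lemma closure_of_scott_singleton: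
  assumes "x \<in> P"
  shows "scott_topology P closure_of {x} = down P {x}"
proof (rule closure_of_unique)
  show "{x} \<subseteq> down P {x}" using assms by (simp add: down_def)
  show "closedin (scott_topology P) (down P {x})"
    using assms by (simp add: closedin_scott_topology scott_closed_down_singleton)
  show "down P {x} \<subseteq> T" if "{x} \<subseteq> T" "closedin (scott_topology P) T" for T
  proof -
    have "down P {x} \<subseteq> down P T" using that(1) by (auto simp: down_def)
    also have "\<dots> = T" using that(2) by (simp add: closedin_scott_topology scott_closed_def)
    finally show ?thesis .
  qed
qed

lemma specialization_le_scott:
  "x \<in> P \<Longrightarrow> y \<in> P \<Longrightarrow> specialization_le (scott_topology P) x y \<longleftrightarrow> x \<le> y"
  by (simp add: specialization_le_def closure_of_scott_singleton down_def)

end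

theory Submission
  imports Defs
begin

text \<open>
  Let \<open>\<Phi>\<close> be an isomorphism from \<open>C_sigma P\<close> to \<open>C_sigma Q\<close>, and call \<open>p \<in> P\<close> and \<open>q \<in> Q\<close>
  \<^emph>\<open>matched\<close> if \<open>\<Phi>\<close> carries the principal ideal of \<open>p\<close> to that of \<open>q\<close>.  Matching reflects and
  preserves the order, so it is an isomorphism as soon as every element on either side has a match.

  Two facts hold without any continuity.  First, matching is closed under directed suprema
  (\<open>matched_Lub\<close>), because the ideal of a directed supremum is the least Scott closed set
  containing the directed set.  Second, if \<open>q\<close> lies in \<open>\<Phi>\<close> of the ideal of some \<open>e \<in> P\<close>, then
  \<open>q\<close> has a match below \<open>e\<close> (\<open>matched_below\<close>): the Scott closed set corresponding to the ideal of
  \<open>q\<close> is irreducible and bounded by \<open>e\<close>, so bounded sobriety makes it an ideal.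

  Consequently the set \<open>E\<close> of matched elements of \<open>P\<close> is closed under directed suprema, and it is
  dense in every principal ideal of \<open>P\<close>.  The heart of the proof is that in a quasicontinuous dcpo
  such a set is everything (\<open>quasicontinuous_dense_subset\<close>): a finite \<open>F \<lless> z\<close> can be interpolated
  by a finite set of points way above \<open>F\<close>, density moves each of these points down into \<open>E\<close>
  without leaving the open set of points way above \<open>F\<close>, and Rudin's lemma extracts from the
  resulting finite subsets of \<open>E\<close> a directed set with supremum \<open>z\<close>.  Applied to the principal
  ideals, this puts all quasicontinuous elements into \<open>E\<close>, and hence all of \<open>P\<close>.

  Finally, the set of matched elements of \<open>Q\<close> is Scott closed by the same two facts.  Since every
  element of \<open>P\<close> has its match there, the Scott closed set of \<open>P\<close> corresponding to it is all of
  \<open>P\<close>, so this set is all of \<open>Q\<close> (\<open>matched_all_Q\<close>).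
\<close>

section \<open>Suprema and Scott closed sets\<close>

lemma isLub_iff:
  "isLub P D s \<longleftrightarrow> s \<in> P \<and> (\<forall>d\<in>D. d \<le> s) \<and> (\<forall>u\<in>P. (\<forall>d\<in>D. d \<le> u) \<longrightarrow> s \<le> u)"
  by (auto simp: isLub_def leastP_def isUb_def setle_def setge_def)

lemma scott_closed_iff:
  "scott_closed P A \<longleftrightarrow> A \<subseteq> P \<and> (\<forall>x\<in>P. \<forall>y\<in>A. x \<le> y \<longrightarrow> x \<in> A) \<and>
     (\<forall>D s. D \<subseteq> A \<longrightarrow> directed_set D \<longrightarrow> isLub P D s \<longrightarrow> s \<in> A)"
proof -
  have "A = {x \<in> P. \<exists>y\<in>A. x \<le> y} \<longleftrightarrow> (\<forall>x\<in>P. \<forall>y\<in>A. x \<le> y \<longrightarrow> x \<in> A)" if "A \<subseteq> P"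
    using that by auto
  then show ?thesis unfolding scott_closed_def down_def by meson
qed

lemma scott_closed_lower:
  "scott_closed P A \<Longrightarrow> y \<in> A \<Longrightarrow> x \<in> P \<Longrightarrow> x \<le> y \<Longrightarrow> x \<in> A"
  by (auto simp: scott_closed_iff)

lemma scott_closed_Lub:
  "scott_closed P A \<Longrightarrow> D \<subseteq> A \<Longrightarrow> directed_set D \<Longrightarrow> isLub P D s \<Longrightarrow> s \<in> A"
  by (auto simp: scott_closed_iff)

lemma down_singleton_subset_iff:
  "scott_closed P A \<Longrightarrow> x \<in> P \<Longrightarrow> down P {x} \<subseteq> A \<longleftrightarrow> x \<in> A"
  by (auto simp: scott_closed_iff down_def)

lemma mem_down_singleton: "y \<in> down P {x} \<longleftrightarrow> y \<in> P \<and> y \<le> x"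
  by (simp add: down_def)

lemma isLub_imp_isLub_down_singleton:
  assumes "x \<in> P" "D \<subseteq> down P {x}" "isLub P D s"
  shows "isLub (down P {x}) D s"
proof -
  have "\<forall>d\<in>D. d \<le> x" using assms(2) by (auto simp: down_def)
  then have "s \<le> x" using assms(1,3) by (simp add: isLub_iff)
  then show ?thesis using assms(3) by (simp add: isLub_iff mem_down_singleton)
qed

text \<open>
  A supremum in the ideal of \<open>x\<close> need not lie below the upper bounds in \<open>P\<close> that are not below \<open>x\<close>.
  If \<open>D\<close> has a supremum in \<open>P\<close>, however, then it lies in the ideal and the two suprema coincide;
  directedness of \<open>D\<close> is what provides it.
\<close>

lemma isLub_down_singleton_imp_isLub:
  assumes "dcpo P" "x \<in> P" "D \<subseteq> down P {x}" "directed_set D" "isLub (down P {x}) D s"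
  shows "isLub P D s"
proof -
  have "D \<subseteq> P" using assms(3) by (auto simp: down_def)
  then obtain t where t: "isLub P D t" using assms(1,4) by (auto simp: dcpo_def)
  then have "isLub (down P {x}) D t"
    by (rule isLub_imp_isLub_down_singleton[OF assms(2,3)])
  then have "s = t" using assms(5) by (auto simp: isLub_iff intro: order_antisym)
  then show ?thesis using t by simp
qed

lemma scott_closed_in_down_singleton:
  assumes x: "x \<in> P" and B: "scott_closed (down P {x}) B"
  shows "scott_closed P B"
  unfolding scott_closed_iff
proof (intro conjI ballI allI impI)
  have sub: "B \<subseteq> down P {x}" using B by (auto simp: scott_closed_iff)
  then show "B \<subseteq> P" by (auto simp: down_def)
  show "u \<in> B" if "u \<in> P" "v \<in> B" "u \<le> v" for u v
  proof (rule scott_closed_lower[OF B that(2) _ that(3)])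
    show "u \<in> down P {x}"
      using that sub order_trans unfolding mem_down_singleton subset_iff by blast
  qed
  show "s \<in> B" if "D \<subseteq> B" "directed_set D" "isLub P D s" for D s
    using scott_closed_Lub[OF B that(1,2)] that(3)
      isLub_imp_isLub_down_singleton[OF x order_trans[OF that(1) sub]] by blast
qed

section \<open>Rudin's lemma\<close>

text \<open>
  Among the upper sets that contain \<open>V\<close> and include no member of the family, choose a maximal one
  \<open>M\<close>; finiteness of the members makes Zorn's lemma applicable.  For \<open>x\<close> outside \<open>M\<close>, maximality
  gives a member all of whose elements outside \<open>M\<close> are above \<open>x\<close>.  Filteredness of the family
  then makes the complement of \<open>M\<close> directed within the union of the family.
\<close>

lemma rudin:
  fixes V :: "'a::order set"
  assumes fin: "\<And>F. F \<in> \<F> \<Longrightarrow> finite F" and ne: "\<F> \<noteq> {}"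
    and filtered: "\<And>F1 F2. F1 \<in> \<F> \<Longrightarrow> F2 \<in> \<F> \<Longrightarrow>
      \<exists>F3\<in>\<F>. \<forall>z\<in>F3. (\<exists>a\<in>F1. a \<le> z) \<and> (\<exists>b\<in>F2. b \<le> z)"
    and V: "\<And>a b. a \<in> V \<Longrightarrow> a \<le> b \<Longrightarrow> b \<in> V"
    and not_sub: "\<And>F. F \<in> \<F> \<Longrightarrow> \<not> F \<subseteq> V"
  obtains D where "directed_set D" "D \<subseteq> \<Union>\<F> - V" "\<And>F. F \<in> \<F> \<Longrightarrow> D \<inter> F \<noteq> {}"
proof -
  define S where "S = {U. V \<subseteq> U \<and> (\<forall>a b. a \<in> U \<longrightarrow> a \<le> b \<longrightarrow> b \<in> U) \<and> (\<forall>F\<in>\<F>. \<not> F \<subseteq> U)}"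
  have "V \<in> S" using V not_sub by (auto simp: S_def)
  have "\<exists>M\<in>S. \<forall>X\<in>S. M \<subseteq> X \<longrightarrow> X = M"
  proof (rule subset_Zorn_nonempty)
    show "S \<noteq> {}" using \<open>V \<in> S\<close> by blast
    fix \<C> assume ne: "\<C> \<noteq> {}" and chain: "subset.chain S \<C>"
    then have CS: "\<C> \<subseteq> S" by (simp add: subset.chain_def)
    have "\<not> F \<subseteq> \<Union>\<C>" if F: "F \<in> \<F>" for F
    proof
      assume "F \<subseteq> \<Union>\<C>"
      then obtain U where "U \<in> \<C>" "F \<subseteq> U"
        using finite_subset_Union_chain[OF fin[OF F] _ ne chain] by blast
      then show False using CS F by (auto simp: S_def)
    qed
    moreover have "V \<subseteq> \<Union>\<C>" using ne CS by (fastforce simp: S_def)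
    moreover have "b \<in> \<Union>\<C>" if "a \<in> \<Union>\<C>" "a \<le> b" for a b
      using that CS unfolding S_def by blast
    ultimately show "\<Union>\<C> \<in> S" by (auto simp: S_def)
  qed
  then obtain M where M: "M \<in> S" and max: "\<And>X. X \<in> S \<Longrightarrow> M \<subseteq> X \<Longrightarrow> X = M" by blast
  have upM: "b \<in> M" if "a \<in> M" "a \<le> b" for a b using M that by (auto simp: S_def)
  have meets: "(\<Union>\<F> - M) \<inter> F \<noteq> {}" if "F \<in> \<F>" for F
    using M that unfolding S_def by blast
  have above: "\<exists>F\<in>\<F>. \<forall>a\<in>F - M. x \<le> a" if x: "x \<notin> M" for x
  proof (rule ccontr)
    assume "\<not> ?thesis"
    then have "\<forall>F\<in>\<F>. \<not> F \<subseteq> M \<union> {a. x \<le> a}" by blast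
    then have "M \<union> {a. x \<le> a} \<in> S" using M by (auto simp: S_def intro: order_trans)
    from max[OF this] x show False by blast
  qed
  have "directed_set (\<Union>\<F> - M)"
    unfolding directed_set_def
  proof (intro conjI ballI)
    show "\<Union>\<F> - M \<noteq> {}" using meets ne by blast
    fix x y assume "x \<in> \<Union>\<F> - M" "y \<in> \<Union>\<F> - M"
    then obtain F1 F2 where F1: "F1 \<in> \<F>" "\<forall>a\<in>F1 - M. x \<le> a"
      and F2: "F2 \<in> \<F>" "\<forall>a\<in>F2 - M. y \<le> a"
      using above[of x] above[of y] by blast
    from filtered[OF F1(1) F2(1)] obtain F3 where F3: "F3 \<in> \<F>"
      "\<forall>z\<in>F3. (\<exists>a\<in>F1. a \<le> z) \<and> (\<exists>b\<in>F2. b \<le> z)" by blast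
    from meets[OF F3(1)] obtain z where z: "z \<in> \<Union>\<F> - M" "z \<in> F3" by blast
    from F3(2) z(2) obtain a b where "a \<in> F1" "a \<le> z" "b \<in> F2" "b \<le> z" by blast
    with F1 F2 upM z(1) have "x \<le> z" "y \<le> z" by (meson DiffD2 DiffI order_trans)+
    with z(1) show "\<exists>z\<in>\<Union>\<F> - M. x \<le> z \<and> y \<le> z" by blast
  qed
  moreover have "\<Union>\<F> - M \<subseteq> \<Union>\<F> - V" using M by (auto simp: S_def)
  ultimately show thesis using meets by (rule that)
qed

section \<open>Quasicontinuous dcpos\<close>

lemma way_below_set_mono:
  "way_below_set P F x \<Longrightarrow> x \<le> y \<Longrightarrow> way_below_set P F y"
  unfolding way_below_set_def by (meson order_trans)

lemma way_below_set_refine: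
  assumes F: "way_below_set P F x" and sub: "F \<subseteq> up P G"
  shows "way_below_set P G x"
proof -
  have "up P F \<subseteq> up P G" using sub unfolding up_def by (blast intro: order_trans)
  then show ?thesis using F unfolding way_below_set_def by blast
qed

lemma way_below_set_imp_up:
  assumes "way_below_set P F x" "x \<in> P"
  shows "x \<in> up P F"
proof -
  have "directed_set {x}" "isLub P {x} x" using assms(2) by (auto simp: directed_set_def isLub_iff)
  then show ?thesis using assms unfolding way_below_set_def
    by (metis Int_insert_left_if0 Int_empty_left empty_subsetI insert_subset order_refl)
qed

lemma fin_filtered:
  assumes "quasicontinuous P" "x \<in> P" "F1 \<in> fin P x" "F2 \<in> fin P x"
  shows "\<exists>F\<in>fin P x. \<forall>z\<in>F. (\<exists>a\<in>F1. a \<le> z) \<and> (\<exists>b\<in>F2. b \<le> z)"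
proof -
  obtain F where "F \<in> fin P x" "F \<subseteq> up P F1 \<inter> up P F2"
    using assms unfolding quasicontinuous_def by meson
  then show ?thesis by (auto simp: up_def subset_iff)
qed

lemma quasicontinuous_le_by_fin:
  assumes "quasicontinuous P" "x \<in> P" "y \<in> P" "\<And>F. F \<in> fin P x \<Longrightarrow> \<exists>a\<in>F. a \<le> y"
  shows "x \<le> y"
  using assms unfolding quasicontinuous_def up_def by blast

text \<open>
  If every finite set way below \<open>x\<close> met the closed set \<open>C\<close>, then Rudin's lemma would give a directed
  subset of \<open>C\<close> meeting all of these finite sets; its supremum is in \<open>C\<close> and above \<open>x\<close>.
\<close>

lemma fin_avoids_scott_closed:
  assumes q: "quasicontinuous P" and x: "x \<in> P" and C: "scott_closed P C" and xC: "x \<notin> C"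
  shows "\<exists>F\<in>fin P x. F \<inter> C = {}"
proof (rule ccontr)
  assume meets: "\<not> ?thesis"
  obtain D where D: "directed_set D" "D \<subseteq> \<Union>(fin P x) - {b. \<forall>c\<in>C. \<not> b \<le> c}"
    "\<And>F. F \<in> fin P x \<Longrightarrow> D \<inter> F \<noteq> {}"
  proof (rule rudin[of "fin P x" "{b. \<forall>c\<in>C. \<not> b \<le> c}"])
    show "finite F" if "F \<in> fin P x" for F using that by (simp add: fin_def)
    show "fin P x \<noteq> {}" using q x by (simp add: quasicontinuous_def)
    show "b \<in> {b. \<forall>c\<in>C. \<not> b \<le> c}" if "a \<in> {b. \<forall>c\<in>C. \<not> b \<le> c}" "a \<le> b" for a b
      using that by (auto dest: order_trans)
    show "\<not> F \<subseteq> {b. \<forall>c\<in>C. \<not> b \<le> c}" if "F \<in> fin P x" for F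
      using that meets by blast
  qed (use fin_filtered[OF q x] in blast)+
  have DC: "D \<subseteq> C"
    using D(2) scott_closed_lower[OF C] by (fastforce simp: fin_def)
  then have DP: "D \<subseteq> P" using C by (auto simp: scott_closed_iff)
  then obtain s where s: "isLub P D s" using q D(1) by (auto simp: quasicontinuous_def dcpo_def)
  have "x \<le> s"
    using quasicontinuous_le_by_fin[OF q x] D(3) s unfolding isLub_iff by blast
  with scott_closed_Lub[OF C DC D(1) s] scott_closed_lower[OF C] x xC show False by blast
qed

text \<open>
  The points way above a finite set \<open>F\<close> form a Scott open set.  For a directed set \<open>D\<close> with
  \<open>F \<lless> \<Squnion>D\<close>, the finite sets way below members of \<open>D\<close> form a filtered family; if none of them
  were contained in the upper set of \<open>F\<close>, Rudin's lemma would give a directed set that avoids this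
  upper set although its supremum is above \<open>\<Squnion>D\<close>.
\<close>

lemma scott_closed_not_way_above:
  assumes q: "quasicontinuous P"
  shows "scott_closed P {w \<in> P. \<not> way_below_set P F w}"
  unfolding scott_closed_iff
proof (intro conjI ballI allI impI)
  show "{w \<in> P. \<not> way_below_set P F w} \<subseteq> P" by blast
  show "u \<in> {w \<in> P. \<not> way_below_set P F w}"
    if "u \<in> P" "v \<in> {w \<in> P. \<not> way_below_set P F w}" "u \<le> v" for u v
    using that way_below_set_mono by blast
  fix D s
  assume D: "D \<subseteq> {w \<in> P. \<not> way_below_set P F w}" and dir: "directed_set D" and s: "isLub P D s"
  have sP: "s \<in> P" using s by (simp add: isLub_iff)
  have "\<not> way_below_set P F s"
  proof
    assume Fs: "way_below_set P F s"
    define \<F> where "\<F> = (\<Union>d\<in>D. fin P d)"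
    define V where "V = {b. \<exists>a\<in>F. a \<le> b}"
    have finP: "G \<subseteq> P" "finite G" if "G \<in> \<F>" for G using that by (auto simp: \<F>_def fin_def)
    have fin_mono: "fin P d \<subseteq> fin P e" if "d \<le> e" for d e
      using way_below_set_mono that by (auto simp: fin_def)
    obtain D' where D': "directed_set D'" "D' \<subseteq> \<Union>\<F> - V" "\<And>G. G \<in> \<F> \<Longrightarrow> D' \<inter> G \<noteq> {}"
    proof (rule rudin[of \<F> V])
      show "\<F> \<noteq> {}"
      proof -
        obtain d where "d \<in> D" using dir by (auto simp: directed_set_def)
        moreover then have "fin P d \<noteq> {}" using q D unfolding quasicontinuous_def by blast
        ultimately show ?thesis by (auto simp: \<F>_def)
      qed
      show "\<exists>G3\<in>\<F>. \<forall>z\<in>G3. (\<exists>a\<in>G1. a \<le> z) \<and> (\<exists>b\<in>G2. b \<le> z)"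
        if G12: "G1 \<in> \<F>" "G2 \<in> \<F>" for G1 G2
      proof -
        obtain d e where "d \<in> D" "G1 \<in> fin P d" "e \<in> D" "G2 \<in> fin P e"
          using G12 unfolding \<F>_def by blast
        moreover then obtain c where "c \<in> D" "d \<le> c" "e \<le> c"
          using dir unfolding directed_set_def by blast
        ultimately have "c \<in> P" "G1 \<in> fin P c" "G2 \<in> fin P c" "fin P c \<subseteq> \<F>"
          using fin_mono[of d c] fin_mono[of e c] D by (auto simp: \<F>_def)
        then show ?thesis using fin_filtered[OF q, of c G1 G2] by blast
      qed
      show "b \<in> V" if "a \<in> V" "a \<le> b" for a b
        using that by (auto simp: V_def intro: order_trans)
      show "\<not> G \<subseteq> V" if "G \<in> \<F>" for G
      proof
        assume "G \<subseteq> V"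
        then have "G \<subseteq> up P F" using finP[OF that] by (auto simp: up_def V_def)
        moreover obtain d where "d \<in> D" "way_below_set P G d"
          using \<open>G \<in> \<F>\<close> by (auto simp: \<F>_def fin_def)
        ultimately show False using way_below_set_refine D by blast
      qed
    qed (use finP in auto)
    have D'P: "D' \<subseteq> P" using D'(2) finP by blast
    then obtain t where t: "isLub P D' t"
      using q D'(1) by (auto simp: quasicontinuous_def dcpo_def)
    have "d \<le> t" if d: "d \<in> D" for d
    proof (rule quasicontinuous_le_by_fin[OF q])
      show "\<exists>a\<in>G. a \<le> t" if "G \<in> fin P d" for G
        using D'(3)[of G] that d t by (auto simp: \<F>_def isLub_iff)
    qed (use d D t in \<open>auto simp: isLub_iff\<close>)
    then have "s \<le> t" using s t by (simp add: isLub_iff)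
    then have "D' \<inter> up P F \<noteq> {}"
      using Fs D'P D'(1) t unfolding way_below_set_def by blast
    then show False using D'(2) by (auto simp: up_def V_def)
  qed
  with sP show "s \<in> {w \<in> P. \<not> way_below_set P F w}" by blast
qed

text \<open>
  The density hypothesis says that \<open>E\<close> meets every Scott open neighbourhood of \<open>e\<close> below \<open>e\<close>.
  For \<open>F \<lless> z\<close> take a finite \<open>F' \<lless> z\<close> with \<open>F \<lless> e\<close> for all \<open>e \<in> F'\<close>, and move every \<open>e \<in> F'\<close> down
  into \<open>E\<close> within the open set of points way above \<open>F\<close>.  Hence the finite subsets of \<open>E\<close> way below
  \<open>z\<close> are cofinal in \<open>fin P z\<close>, and Rudin's lemma, applied below \<open>z\<close>, shows that \<open>z\<close> is the
  supremum of a directed subset of \<open>E\<close>.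
\<close>

lemma quasicontinuous_dense_subset:
  assumes q: "quasicontinuous P" and EP: "E \<subseteq> P"
    and Lub: "\<And>D s. D \<subseteq> E \<Longrightarrow> directed_set D \<Longrightarrow> isLub P D s \<Longrightarrow> s \<in> E"
    and dense: "\<And>e B. e \<in> P \<Longrightarrow> scott_closed P B \<Longrightarrow> E \<inter> down P {e} \<subseteq> B \<Longrightarrow> e \<in> B"
  shows "P \<subseteq> E"
proof
  fix z assume z: "z \<in> P"
  define \<G> where "\<G> = {G \<in> fin P z. G \<subseteq> E}"
  have cofinal: "\<exists>G\<in>\<G>. G \<subseteq> up P F" if F: "F \<in> fin P z" for F
  proof -
    let ?C = "{w \<in> P. \<not> way_below_set P F w}"
    have C: "scott_closed P ?C" by (rule scott_closed_not_way_above[OF q])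
    have "z \<notin> ?C" using F by (simp add: fin_def)
    then obtain F' where F': "F' \<in> fin P z" "F' \<inter> ?C = {}"
      using fin_avoids_scott_closed[OF q z C] by blast
    have "\<exists>u. u \<in> E \<and> u \<le> e \<and> way_below_set P F u" if "e \<in> F'" for e
    proof (rule ccontr)
      assume "\<not> ?thesis"
      then have "E \<inter> down P {e} \<subseteq> ?C" using EP by (auto simp: down_def)
      then have "e \<in> ?C" using dense[OF _ C] F'(1) that by (auto simp: fin_def)
      then show False using F'(2) that by blast
    qed
    then obtain u where u: "\<And>e. e \<in> F' \<Longrightarrow> u e \<in> E \<and> u e \<le> e \<and> way_below_set P F (u e)"
      by metis
    have "F' \<subseteq> up P (u ` F')" using u F'(1) by (auto simp: up_def fin_def)
    then have "way_below_set P (u ` F') z"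
      using F'(1) way_below_set_refine by (auto simp: fin_def)
    then have "u ` F' \<in> \<G>" using u F'(1) EP by (auto simp: \<G>_def fin_def)
    moreover have "u ` F' \<subseteq> up P F" using u EP by (auto intro!: way_below_set_imp_up)
    ultimately show ?thesis by blast
  qed
  obtain D where D: "directed_set D" "D \<subseteq> \<Union>\<G> - {w. \<not> w \<le> z}" "\<And>G. G \<in> \<G> \<Longrightarrow> D \<inter> G \<noteq> {}"
  proof (rule rudin[of \<G> "{w. \<not> w \<le> z}"])
    show "finite G" if "G \<in> \<G>" for G using that by (simp add: \<G>_def fin_def)
    show "\<G> \<noteq> {}" using q z cofinal by (fastforce simp: quasicontinuous_def)
    show "\<exists>G3\<in>\<G>. \<forall>z\<in>G3. (\<exists>a\<in>G1. a \<le> z) \<and> (\<exists>b\<in>G2. b \<le> z)"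
      if G12: "G1 \<in> \<G>" "G2 \<in> \<G>" for G1 G2
    proof -
      obtain F where F: "F \<in> fin P z" "\<forall>z\<in>F. (\<exists>a\<in>G1. a \<le> z) \<and> (\<exists>b\<in>G2. b \<le> z)"
        using fin_filtered[OF q z, of G1 G2] G12 unfolding \<G>_def by blast
      obtain G where "G \<in> \<G>" "G \<subseteq> up P F" using cofinal[OF F(1)] by blast
      moreover have "(\<exists>a\<in>G1. a \<le> w) \<and> (\<exists>b\<in>G2. b \<le> w)" if w: "w \<in> G" for w
      proof -
        obtain v where v: "v \<in> F" "v \<le> w" using \<open>G \<subseteq> up P F\<close> w by (auto simp: up_def)
        then show ?thesis using F(2) by (meson order_trans)
      qed
      ultimately show ?thesis by blast
    qed
    show "b \<in> {w. \<not> w \<le> z}" if "a \<in> {w. \<not> w \<le> z}" "a \<le> b" for a b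
      using that by (auto dest: order_trans)
    show "\<not> G \<subseteq> {w. \<not> w \<le> z}" if "G \<in> \<G>" for G
      using that way_below_set_imp_up[OF _ z] by (auto simp: \<G>_def fin_def up_def)
  qed blast
  have DE: "D \<subseteq> E" using D(2) by (auto simp: \<G>_def)
  then obtain s where s: "isLub P D s"
    using q D(1) EP unfolding quasicontinuous_def dcpo_def by (meson order_trans)
  have "z \<le> s"
  proof (rule quasicontinuous_le_by_fin[OF q z])
    show "\<exists>a\<in>F. a \<le> s" if F: "F \<in> fin P z" for F
    proof -
      obtain G where G: "G \<in> \<G>" "G \<subseteq> up P F" using cofinal[OF F] by blast
      then obtain d where d: "d \<in> D" "d \<in> up P F" using D(3) by blast
      then obtain a where "a \<in> F" "a \<le> d" by (auto simp: up_def)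
      moreover have "d \<le> s" using d(1) s by (simp add: isLub_iff)
      ultimately show ?thesis by (blast intro: order_trans)
    qed
  qed (use s in \<open>simp add: isLub_iff\<close>)
  moreover have "s \<le> z" using s z D(2) by (auto simp: isLub_iff)
  ultimately show "z \<in> E" using Lub[OF DE D(1) s] by simp
qed

section \<open>Matching elements along an isomorphism of the Scott closed set lattices\<close>

text \<open>
  An order isomorphism with inverse \<open>\<Psi>\<close>, expressed by the two adjunctions it satisfies; this is the
  form in which it is applied below.
\<close>

locale scott_closed_iso =
  fixes P :: "'a::order set" and Q :: "'b::order set"
    and \<Phi> :: "'a set \<Rightarrow> 'b set" and \<Psi> :: "'b set \<Rightarrow> 'a set"
  assumes closed_\<Phi>: "scott_closed P A \<Longrightarrow> scott_closed Q (\<Phi> A)"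
    and closed_\<Psi>: "scott_closed Q B \<Longrightarrow> scott_closed P (\<Psi> B)"
    and \<Phi>_le_iff: "scott_closed P A \<Longrightarrow> scott_closed Q B \<Longrightarrow> \<Phi> A \<subseteq> B \<longleftrightarrow> A \<subseteq> \<Psi> B"
    and le_\<Phi>_iff: "scott_closed P A \<Longrightarrow> scott_closed Q B \<Longrightarrow> B \<subseteq> \<Phi> A \<longleftrightarrow> \<Psi> B \<subseteq> A"
begin

lemma \<Psi>_\<Phi>: "scott_closed P A \<Longrightarrow> \<Psi> (\<Phi> A) = A"
  using \<Phi>_le_iff[of A "\<Phi> A"] le_\<Phi>_iff[of A "\<Phi> A"] closed_\<Phi>[of A] by simp

lemma \<Phi>_\<Psi>: "scott_closed Q B \<Longrightarrow> \<Phi> (\<Psi> B) = B"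
  using \<Phi>_le_iff[of "\<Psi> B" B] le_\<Phi>_iff[of "\<Psi> B" B] closed_\<Psi>[of B] by simp

lemma \<Phi>_mono_iff:
  "scott_closed P A \<Longrightarrow> scott_closed P A' \<Longrightarrow> \<Phi> A \<subseteq> \<Phi> A' \<longleftrightarrow> A \<subseteq> A'"
  using \<Phi>_le_iff[of A "\<Phi> A'"] \<Psi>_\<Phi>[of A'] closed_\<Phi>[of A'] by simp

definition matched :: "'a \<Rightarrow> 'b \<Rightarrow> bool" where
  "matched p q \<longleftrightarrow> p \<in> P \<and> q \<in> Q \<and> \<Phi> (down P {p}) = down Q {q}"

lemma matched_le_iff:
  assumes "matched p q" "matched p' q'"
  shows "p \<le> p' \<longleftrightarrow> q \<le> q'"
proof -
  have "p \<le> p' \<longleftrightarrow> down P {p} \<subseteq> down P {p'}"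
    using assms by (auto simp: matched_def down_singleton_subset_iff scott_closed_down_singleton
        mem_down_singleton)
  also have "\<dots> \<longleftrightarrow> down Q {q} \<subseteq> down Q {q'}"
    using assms \<Phi>_mono_iff scott_closed_down_singleton unfolding matched_def by metis
  also have "\<dots> \<longleftrightarrow> q \<le> q'"
    using assms by (auto simp: matched_def down_singleton_subset_iff scott_closed_down_singleton
        mem_down_singleton)
  finally show ?thesis .
qed

lemma matched_mem_iff:
  assumes "matched p q" "scott_closed P A"
  shows "q \<in> \<Phi> A \<longleftrightarrow> p \<in> A"
  using assms \<Phi>_mono_iff closed_\<Phi> down_singleton_subset_iff scott_closed_down_singleton
  unfolding matched_def by metis

lemma matched_mem_\<Psi>_iff:
  "matched p q \<Longrightarrow> scott_closed Q B \<Longrightarrow> p \<in> \<Psi> B \<longleftrightarrow> q \<in> B"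
  using matched_mem_iff[of p q "\<Psi> B"] closed_\<Psi> \<Phi>_\<Psi> by simp

text \<open>
  The directed sets are related rather than parametrized, so that the lemma serves to close both
  the matched elements of \<open>P\<close> and those of \<open>Q\<close> under directed suprema.
\<close>

lemma matched_Lub:
  assumes D: "directed_set D" "isLub P D s" and D': "directed_set D'" "isLub Q D' t"
    and tot: "\<forall>d\<in>D. \<exists>d'\<in>D'. matched d d'" and surj: "\<forall>d'\<in>D'. \<exists>d\<in>D. matched d d'"
  shows "matched s t"
proof -
  have sP: "s \<in> P" and tQ: "t \<in> Q" using D D' by (auto simp: isLub_iff)
  note cs = scott_closed_down_singleton[OF sP] and ct = scott_closed_down_singleton[OF tQ]
  have "D' \<subseteq> \<Phi> (down P {s})"
  proof
    fix d' assume "d' \<in> D'"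
    then obtain d where d: "d \<in> D" "matched d d'" using surj by blast
    then have "d \<in> down P {s}" using D(2) by (auto simp: isLub_iff down_def matched_def)
    with d(2) show "d' \<in> \<Phi> (down P {s})" by (simp add: matched_mem_iff cs)
  qed
  then have "t \<in> \<Phi> (down P {s})" using scott_closed_Lub[OF closed_\<Phi>[OF cs]] D' by blast
  moreover have "D \<subseteq> \<Psi> (down Q {t})"
  proof
    fix d assume "d \<in> D"
    then obtain d' where d': "d' \<in> D'" "matched d d'" using tot by blast
    then have "d' \<in> down Q {t}" using D'(2) by (auto simp: isLub_iff down_def matched_def)
    with d'(2) show "d \<in> \<Psi> (down Q {t})" by (simp add: matched_mem_\<Psi>_iff ct)
  qed
  then have "s \<in> \<Psi> (down Q {t})" using scott_closed_Lub[OF closed_\<Psi>[OF ct]] D by blast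
  ultimately have "\<Phi> (down P {s}) = down Q {t}"
    by (simp add: subset_antisym \<Phi>_le_iff cs ct down_singleton_subset_iff closed_\<Phi> closed_\<Psi> sP tQ)
  with sP tQ show ?thesis by (simp add: matched_def)
qed

lemma matched_Lub_P:
  assumes "dcpo Q" and D: "D \<subseteq> {p. \<exists>q. matched p q}" "directed_set D" "isLub P D s"
  shows "\<exists>t. matched s t"
proof -
  let ?D' = "{q. \<exists>d\<in>D. matched d q}"
  have dir: "directed_set ?D'"
    unfolding directed_set_def
  proof (intro conjI ballI)
    show "?D' \<noteq> {}" using D unfolding directed_set_def by blast
    fix x y assume "x \<in> ?D'" "y \<in> ?D'"
    then obtain d e where de: "d \<in> D" "matched d x" "e \<in> D" "matched e y" by blast
    then obtain c where c: "c \<in> D" "d \<le> c" "e \<le> c" using D(2) unfolding directed_set_def by blast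
    then obtain z where "matched c z" using D(1) by blast
    with c de show "\<exists>z\<in>?D'. x \<le> z \<and> y \<le> z" using matched_le_iff by blast
  qed
  have "?D' \<subseteq> Q" by (auto simp: matched_def)
  then obtain t where "isLub Q ?D' t" using assms(1) dir unfolding dcpo_def by blast
  then show ?thesis using matched_Lub[OF D(2,3) dir] D(1) by blast
qed

lemma matched_Lub_Q:
  assumes "dcpo P" and D: "D \<subseteq> {q. \<exists>p. matched p q}" "directed_set D" "isLub Q D t"
  shows "\<exists>s. matched s t"
proof -
  let ?D' = "{p. \<exists>d\<in>D. matched p d}"
  have dir: "directed_set ?D'"
    unfolding directed_set_def
  proof (intro conjI ballI)
    show "?D' \<noteq> {}" using D unfolding directed_set_def by blast
    fix x y assume "x \<in> ?D'" "y \<in> ?D'"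
    then obtain d e where de: "d \<in> D" "matched x d" "e \<in> D" "matched y e" by blast
    then obtain c where c: "c \<in> D" "d \<le> c" "e \<le> c" using D(2) unfolding directed_set_def by blast
    then obtain z where "matched z c" using D(1) by blast
    with c de show "\<exists>z\<in>?D'. x \<le> z \<and> y \<le> z" using matched_le_iff by blast
  qed
  have "?D' \<subseteq> P" by (auto simp: matched_def)
  then obtain s where "isLub P ?D' s" using assms(1) dir unfolding dcpo_def by blast
  then show ?thesis using matched_Lub[OF dir _ D(2,3)] D(1) by blast
qed

text \<open>
  Irreducibility of the ideal of \<open>q\<close> is transported to \<open>\<Psi>\<close> of it: if that set is covered by closed
  \<open>F1\<close> and \<open>F2\<close>, then the ideal of \<open>q\<close> is covered by \<open>\<Phi> F1 \<union> \<Phi> F2\<close>, and \<open>q\<close> lies in one of the two.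
\<close>

lemma \<Psi>_ideal_irreducible:
  assumes q: "q \<in> Q"
  shows "irreducible_in (scott_topology P) (\<Psi> (down Q {q}))"
  unfolding irreducible_in_def closedin_scott_topology
proof (intro allI impI)
  note cq = scott_closed_down_singleton[OF q]
  fix F1 F2
  assume F: "scott_closed P F1 \<and> scott_closed P F2 \<and> \<Psi> (down Q {q}) \<subseteq> F1 \<union> F2"
  then have cF: "scott_closed P F1" "scott_closed P F2" by auto
  have cU: "scott_closed Q (\<Phi> F1 \<union> \<Phi> F2)" using cF by (simp add: closed_\<Phi> scott_closed_Un)
  have "F1 \<subseteq> \<Psi> (\<Phi> F1 \<union> \<Phi> F2)" "F2 \<subseteq> \<Psi> (\<Phi> F1 \<union> \<Phi> F2)"
    using \<Phi>_le_iff[OF _ cU] cF by blast+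
  then have "\<Psi> (down Q {q}) \<subseteq> \<Psi> (\<Phi> F1 \<union> \<Phi> F2)" using F by blast
  then have "down Q {q} \<subseteq> \<Phi> F1 \<union> \<Phi> F2"
    using \<Phi>_le_iff[OF closed_\<Psi>[OF cq] cU] by (simp add: \<Phi>_\<Psi> cq)
  then have "q \<in> \<Phi> F1 \<or> q \<in> \<Phi> F2" using q by (auto simp: mem_down_singleton)
  then show "\<Psi> (down Q {q}) \<subseteq> F1 \<or> \<Psi> (down Q {q}) \<subseteq> F2"
    using le_\<Phi>_iff[OF _ cq] cF by (simp flip: down_singleton_subset_iff[OF closed_\<Phi> q])
qed

text \<open>
  Bounded sobriety enters here: \<open>\<Psi>\<close> of the ideal of \<open>q\<close> is irreducible and contained in the ideal
  of \<open>e\<close>, so it is itself the ideal of some \<open>p \<le> e\<close>.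
\<close>

lemma matched_below:
  assumes sober: "bounded_sober (scott_topology P)" and e: "e \<in> P" and q: "q \<in> \<Phi> (down P {e})"
  shows "\<exists>p. matched p q \<and> p \<le> e"
proof -
  let ?A = "\<Psi> (down Q {q})"
  note ce = scott_closed_down_singleton[OF e]
  have qQ: "q \<in> Q" using closed_\<Phi>[OF ce] q by (auto simp: scott_closed_iff)
  note cq = scott_closed_down_singleton[OF qQ]
  have A: "scott_closed P ?A" by (rule closed_\<Psi>[OF cq])
  have Ae: "?A \<subseteq> down P {e}"
    using le_\<Phi>_iff[OF ce cq] down_singleton_subset_iff[OF closed_\<Phi>[OF ce] qQ] q by simp
  have "?A \<noteq> {}"
  proof
    assume "?A = {}"
    then have "?A \<subseteq> \<Psi> {}" by simp
    then have "down Q {q} \<subseteq> {}"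
      using \<Phi>_le_iff[OF A scott_closed_empty] by (simp add: \<Phi>_\<Psi> cq)
    then show False using qQ by (auto simp: mem_down_singleton)
  qed
  moreover have "\<forall>a\<in>?A. specialization_le (scott_topology P) a e"
    using Ae e by (auto simp: mem_down_singleton specialization_le_scott)
  ultimately obtain p where p: "p \<in> P" "?A = scott_topology P closure_of {p}"
    using sober A e \<Psi>_ideal_irreducible[OF qQ]
    unfolding bounded_sober_def closedin_scott_topology topspace_scott_topology by meson
  then have Ap: "?A = down P {p}" by (simp add: closure_of_scott_singleton)
  then have "matched p q" using \<Phi>_\<Psi>[OF cq] p(1) qQ by (simp add: matched_def)
  moreover have "p \<le> e" using Ap Ae p(1) by (auto simp: mem_down_singleton)
  ultimately show ?thesis by blast
qed

text \<open>
  Density of the matched elements: \<open>\<Phi>\<close> of the ideal of \<open>e\<close> consists of elements with a match below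
  \<open>e\<close>, so it is contained in \<open>\<Phi> B\<close>.
\<close>

lemma matched_dense:
  assumes sober: "bounded_sober (scott_topology P)" and e: "e \<in> P" and B: "scott_closed P B"
    and sub: "\<And>p q. matched p q \<Longrightarrow> p \<le> e \<Longrightarrow> p \<in> B"
  shows "e \<in> B"
proof -
  note ce = scott_closed_down_singleton[OF e]
  have "\<Phi> (down P {e}) \<subseteq> \<Phi> B"
    using matched_below[OF sober e] sub matched_mem_iff[OF _ B] by blast
  then show ?thesis using \<Phi>_mono_iff[OF ce B] down_singleton_subset_iff[OF B e] by blast
qed

text \<open>
  The ideal of \<open>x\<close> is a quasicontinuous dcpo in its own right, and the matched elements in it are
  dense and closed under directed suprema; so they exhaust it, and \<open>x\<close> is one of them.
\<close>

lemma quasicontinuous_element_matched: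
  assumes "dcpo P" "dcpo Q" and sober: "bounded_sober (scott_topology P)"
    and x: "quasicontinuous_element P x"
  shows "\<exists>q. matched x q"
proof -
  let ?X = "down P {x}" and ?E = "{p \<in> down P {x}. \<exists>q. matched p q}"
  have xP: "x \<in> P" and q: "quasicontinuous ?X"
    using x by (auto simp: quasicontinuous_element_def)
  have "?X \<subseteq> ?E"
  proof (rule quasicontinuous_dense_subset[OF q])
    show "?E \<subseteq> ?X" by blast
    show "s \<in> ?E" if "D \<subseteq> ?E" "directed_set D" "isLub ?X D s" for D s
    proof -
      have "D \<subseteq> ?X" using that(1) by blast
      then have "isLub P D s"
        using isLub_down_singleton_imp_isLub[OF assms(1) xP] that(2,3) by blast
      then have "\<exists>t. matched s t" using matched_Lub_P[OF assms(2) _ that(2)] that(1) by blast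
      moreover have "s \<in> ?X" using that(3) by (simp add: isLub_iff)
      ultimately show ?thesis by blast
    qed
    show "e \<in> B" if e: "e \<in> ?X" and B: "scott_closed ?X B" and sub: "?E \<inter> down ?X {e} \<subseteq> B" for e B
    proof (rule matched_dense[OF sober _ scott_closed_in_down_singleton[OF xP B]])
      show "e \<in> P" using e by (simp add: mem_down_singleton)
      show "p \<in> B" if "matched p q" "p \<le> e" for p q
        using that e sub by (auto simp: mem_down_singleton matched_def subset_iff)
    qed
  qed
  then show ?thesis using xP by (auto simp: mem_down_singleton)
qed

lemma matched_all_Q:
  assumes "dcpo P" and sober: "bounded_sober (scott_topology P)"
    and all: "\<And>p. p \<in> P \<Longrightarrow> \<exists>q. matched p q" and y: "y \<in> Q"
  shows "\<exists>p. matched p y"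
proof -
  define R where "R = {q \<in> Q. \<exists>p. matched p q}"
  have R: "scott_closed Q R"
    unfolding scott_closed_iff
  proof (intro conjI ballI allI impI)
    show "R \<subseteq> Q" by (auto simp: R_def)
    show "u \<in> R" if u: "u \<in> Q" "v \<in> R" "u \<le> v" for u v
    proof -
      obtain p where p: "matched p v" using u by (auto simp: R_def)
      then have "u \<in> \<Phi> (down P {p})" using u by (simp add: matched_def mem_down_singleton)
      then show ?thesis using matched_below[OF sober, of p u] p u by (auto simp: R_def matched_def)
    qed
    show "t \<in> R" if "D \<subseteq> R" "directed_set D" "isLub Q D t" for D t
      using matched_Lub_Q[OF assms(1) _ that(2,3)] that(1,3) by (auto simp: R_def isLub_iff)
  qed
  note cy = scott_closed_down_singleton[OF y]
  \<comment> \<open>Every element of \<open>P\<close> is matched with an element of \<open>R\<close>, so \<open>\<Psi> R\<close> contains everything.\<close>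
  have "\<Psi> (down Q {y}) \<subseteq> \<Psi> R"
  proof
    fix p assume p: "p \<in> \<Psi> (down Q {y})"
    then have "p \<in> P" using closed_\<Psi>[OF cy] by (auto simp: scott_closed_iff)
    then obtain q where q: "matched p q" using all by blast
    then have "q \<in> R" by (auto simp: R_def matched_def)
    then show "p \<in> \<Psi> R" using matched_mem_\<Psi>_iff[OF q R] by simp
  qed
  then have "down Q {y} \<subseteq> R" using \<Phi>_le_iff[OF closed_\<Psi>[OF cy] R] \<Phi>_\<Psi>[OF cy] by simp
  then show ?thesis using y by (auto simp: R_def mem_down_singleton)
qed

lemma order_isomorphic_if_matched:
  assumes P: "\<And>p. p \<in> P \<Longrightarrow> \<exists>q. matched p q" and Q: "\<And>q. q \<in> Q \<Longrightarrow> \<exists>p. matched p q"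
  shows "order_isomorphic P Q"
proof -
  obtain f where f: "\<And>p. p \<in> P \<Longrightarrow> matched p (f p)" using P by metis
  have le: "f x \<le> f y \<longleftrightarrow> x \<le> y" if "x \<in> P" "y \<in> P" for x y
    using matched_le_iff f that by blast
  have "inj_on f P" using le by (intro inj_onI) (metis order_antisym order_refl)
  moreover have "f ` P = Q"
  proof
    show "f ` P \<subseteq> Q" using f by (auto simp: matched_def)
    show "Q \<subseteq> f ` P"
    proof
      fix q assume "q \<in> Q"
      then obtain p where p: "matched p q" using Q by blast
      then have "p \<in> P" by (simp add: matched_def)
      then have "f p = q" using matched_le_iff p f by (metis order_antisym order_refl)
      with \<open>p \<in> P\<close> show "q \<in> f ` P" by blast
    qed
  qed
  ultimately show ?thesis using le unfolding order_isomorphic_def bij_betw_def by blast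
qed

end

section \<open>Uniqueness of the dcpo with a given lattice of Scott closed sets\<close>

lemma order_isomorphic_C_sigma_obtain:
  assumes "order_isomorphic (C_sigma P) (C_sigma Q)"
  obtains \<Phi> \<Psi> where "scott_closed_iso P Q \<Phi> \<Psi>"
proof -
  obtain \<Phi> where bij: "bij_betw \<Phi> (C_sigma P) (C_sigma Q)"
    and le: "\<forall>A\<in>C_sigma P. \<forall>B\<in>C_sigma P. \<Phi> A \<subseteq> \<Phi> B \<longleftrightarrow> A \<subseteq> B"
    using assms unfolding order_isomorphic_def by blast
  define \<Psi> where "\<Psi> = inv_into (C_sigma P) \<Phi>"
  have \<Phi>: "\<Phi> A \<in> C_sigma Q" if "A \<in> C_sigma P" for A
    using bij that by (rule bij_betw_apply)
  have \<Psi>: "\<Psi> B \<in> C_sigma P" "\<Phi> (\<Psi> B) = B" if "B \<in> C_sigma Q" for B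
    using bij that unfolding \<Psi>_def
    by (auto simp: bij_betw_def inv_into_into f_inv_into_f)
  have "scott_closed_iso P Q \<Phi> \<Psi>"
  proof
    fix A B assume A: "scott_closed P A" and B: "scott_closed Q B"
    then show "\<Phi> A \<subseteq> B \<longleftrightarrow> A \<subseteq> \<Psi> B" "B \<subseteq> \<Phi> A \<longleftrightarrow> \<Psi> B \<subseteq> A"
      using le \<Psi>[of B] unfolding C_sigma_def by (metis mem_Collect_eq)+
  qed (use \<Phi> \<Psi> in \<open>auto simp: C_sigma_def\<close>)
  then show thesis by (rule that)
qed

theorem theorem3p9:
  fixes P :: "'a::order set"
  assumes "dcpo P"
    and "bounded_sober (scott_topology P)"
    and "\<forall>x\<in>P. \<exists>D. D \<subseteq> {q. quasicontinuous_element P q} \<and> directed_set D \<and> isLub P D x"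
  shows "C_sigma_unique TYPE('b::order) P"
  unfolding C_sigma_unique_def
proof (intro allI impI)
  fix Q :: "'b set"
  assume Q: "dcpo Q" and iso: "order_isomorphic (C_sigma P) (C_sigma Q)"
  from iso obtain \<Phi> \<Psi> where "scott_closed_iso P Q \<Phi> \<Psi>"
    by (rule order_isomorphic_C_sigma_obtain)
  then interpret scott_closed_iso P Q \<Phi> \<Psi> .
  have all: "\<exists>q. matched p q" if p: "p \<in> P" for p
  proof -
    obtain D where D: "D \<subseteq> {q. quasicontinuous_element P q}" "directed_set D" "isLub P D p"
      using assms(3) p by blast
    have "D \<subseteq> {p. \<exists>q. matched p q}"
      using D(1) quasicontinuous_element_matched[OF assms(1) Q assms(2)] by blast
    then show ?thesis using matched_Lub_P[OF Q _ D(2,3)] by blast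
  qed
  show "order_isomorphic P Q"
    using all matched_all_Q[OF assms(1,2) all] by (rule order_isomorphic_if_matched)
qed

end
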